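(* Let $\mathsf C$ be a Markov category with conditionals. Every commutative square in $\mathcal S(\mathsf C)$ of the form $$f:\Omega\to X,\quad g:\Omega\to Y,\quad u:X\to Y,\quad \mathrm{id}_Y:Y\to Y,\qquad u\circ f=\mathrm{id}_Y\circ g,$$ is independent.
   Context: A Markov category is a symmetric monoidal category $(\mathsf C,\otimes,I)$ (coherence isomorphisms suppressed) whose unit $I$ is terminal and in which every object $X$ carries a commutative comonoid structure $\mathrm{copy}_X:X\to X\otimes X$, $\mathrm{del}_X:X\to I$ compatible with the monoidal structure ($\mathrm{copy}_{X\otimes Y}$ is $\mathrm{copy}_X\otimes\mathrm{copy}_Y$ followed by the swap of the two middle factors, $\mathrm{del}_{X\otimes Y}=\mathrm{del}_X\otimes\mathrm{del}_Y$, and the structure on $I$ is trivial). The projections $\pi_X:X\otimes Y\to X$, $\pi_Y:X\otimes Y\to Y$ are obtained by deleting the other factor. For $f:A\to X$, $g:A\to Y$ write $\langle f,g\rangle=(f\otimes g)\circ\mathrm{copy}_A$ (similarly for triples, using iterated copy). A state is a morphism $p:I\to X$. $\mathsf C$ has conditionals if for every $f:A\to X\otimes Y$ there is $f|_X:X\otimes A\to Y$ with $f=(\mathrm{id}_X\otimes f|_X)\circ(\mathrm{copy}_X\otimes \mathrm{id}_A)\circ((\pi_X f)\otimes\mathrm{id}_A)\circ\mathrm{copy}_A$. For $f,g:X\to Y$ and a state $p:I\to X$, $f=_p g$ ($p$-almost sure equality) means $\langle \mathrm{id}_X,f\rangle\circ p=\langle\mathrm{id}_X,g\rangle\circ p$;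 $f$ is $p$-almost surely deterministic if $\mathrm{copy}_Y\circ f=_p(f\otimes f)\circ\mathrm{copy}_X$. The category $\mathcal P(\mathsf C)$ of probability spaces has objects $(\Omega,p)$ with $p:I\to\Omega$ a state; morphisms $(\Omega,p)\to(\Omega',q)$ are $p$-almost sure equality classes of $f:\Omega\to\Omega'$ with $f\circ p=q$; composition is that of $\mathsf C$ on representatives. The category $\mathcal S(\mathsf C)$ of sample spaces is the wide subcategory of $\mathcal P(\mathsf C)$ of classes of $p$-almost surely deterministic morphisms. A sample space is denoted by its underlying object $\Omega$, with state $p_\Omega$. A commutative square in $\mathcal S(\mathsf C)$ consisting of $f:\Omega\to X$, $g:\Omega\to Y$, $u:X\to Z$, $v:Y\to Z$ with $d:=uf=vg$ is called independent if there exist morphisms $\phi:Z\to X$ and $\psi:Z\to Y$ in $\mathsf C$ such that $\langle f,d,g\rangle\circ p_\Omega=\langle\phi,\mathrm{id}_Z,\psi\rangle\circ p_Z$ as states $I\to X\otimes Z\otimes Y$. *)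

theory Defs
  imports Main
begin

text \<open>Composition is only meaningful on composable pairs of arrows; \<open>g \<cdot> f\<close> is \<open>g\<close> after \<open>f\<close>.\<close>

record ('o, 'm) cat =
  Obj :: "'o set"
  Arr :: "'m set"
  Dom :: "'m \<Rightarrow> 'o"
  Cod :: "'m \<Rightarrow> 'o"
  Id :: "'o \<Rightarrow> 'm"
  Comp :: "'m \<Rightarrow> 'm \<Rightarrow> 'm" (infixl "\<cdot>\<index>" 65)

definition hom :: "('o, 'm, 'z) cat_scheme \<Rightarrow> 'o \<Rightarrow> 'o \<Rightarrow> 'm set" where
  "hom C A B = {f \<in> Arr C. Dom C f = A \<and> Cod C f = B}"

locale category =
  fixes C :: "('o, 'm, 'z) cat_scheme" (structure)
  assumes Dom_Obj: "f \<in> Arr C \<Longrightarrow> Dom C f \<in> Obj C"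
    and Cod_Obj: "f \<in> Arr C \<Longrightarrow> Cod C f \<in> Obj C"
    and Id_hom: "A \<in> Obj C \<Longrightarrow> Id C A \<in> hom C A A"
    and Comp_hom: "f \<in> hom C A B \<Longrightarrow> g \<in> hom C B D \<Longrightarrow> g \<cdot> f \<in> hom C A D"
    and Comp_Id: "f \<in> hom C A B \<Longrightarrow> f \<cdot> Id C A = f"
    and Id_Comp: "f \<in> hom C A B \<Longrightarrow> Id C B \<cdot> f = f"
    and Comp_assoc:
      "f \<in> hom C A B \<Longrightarrow> g \<in> hom C B D \<Longrightarrow> h \<in> hom C D E \<Longrightarrow> (h \<cdot> g) \<cdot> f = h \<cdot> (g \<cdot> f)"

definition is_inverse :: "('o, 'm, 'z) cat_scheme \<Rightarrow> 'm \<Rightarrow> 'm \<Rightarrow> bool" where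
  "is_inverse C f g \<longleftrightarrow> g \<in> hom C (Cod C f) (Dom C f) \<and>
     Comp C g f = Id C (Dom C f) \<and> Comp C f g = Id C (Cod C f)"

definition iso :: "('o, 'm, 'z) cat_scheme \<Rightarrow> 'm \<Rightarrow> bool" where
  "iso C f \<longleftrightarrow> f \<in> Arr C \<and> (\<exists>g. is_inverse C f g)"

definition inverse_arr :: "('o, 'm, 'z) cat_scheme \<Rightarrow> 'm \<Rightarrow> 'm" where
  "inverse_arr C f = (THE g. is_inverse C f g)"

definition terminal :: "('o, 'm, 'z) cat_scheme \<Rightarrow> 'o \<Rightarrow> bool" where
  "terminal C T \<longleftrightarrow> T \<in> Obj C \<and> (\<forall>A \<in> Obj C. \<exists>!f. f \<in> hom C A T)"

definition commutative_square ::
    "('o, 'm, 'z) cat_scheme \<Rightarrow> 'm \<Rightarrow> 'm \<Rightarrow> 'm \<Rightarrow> 'm \<Rightarrow> bool" where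
  "commutative_square C f g u v \<longleftrightarrow>
     (\<exists>W X Y Z. f \<in> hom C W X \<and> g \<in> hom C W Y \<and> u \<in> hom C X Z \<and> v \<in> hom C Y Z) \<and>
     Comp C u f = Comp C v g"

text \<open>The tensor product is \<open>\<otimes>\<close> on objects and \<open>\<boxtimes>\<close> on arrows. The monoidal structure is not
  assumed to be strict.\<close>

record ('o, 'm) smc = "('o, 'm) cat" +
  Tensor :: "'o \<Rightarrow> 'o \<Rightarrow> 'o" (infixl "\<otimes>\<index>" 70)
  TensorA :: "'m \<Rightarrow> 'm \<Rightarrow> 'm" (infixl "\<boxtimes>\<index>" 70)
  Unit :: "'o" ("\<one>\<index>")
  Assoc :: "'o \<Rightarrow> 'o \<Rightarrow> 'o \<Rightarrow> 'm"
  LUnit :: "'o \<Rightarrow> 'm"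
  RUnit :: "'o \<Rightarrow> 'm"
  Swap :: "'o \<Rightarrow> 'o \<Rightarrow> 'm"

locale symmetric_monoidal_category = category C
  for C :: "('o, 'm, 'z) smc_scheme" (structure) +
  assumes Unit_Obj: "\<one> \<in> Obj C"
    and Tensor_Obj: "A \<in> Obj C \<Longrightarrow> B \<in> Obj C \<Longrightarrow> A \<otimes> B \<in> Obj C"
    and TensorA_hom:
      "f \<in> hom C A B \<Longrightarrow> g \<in> hom C A' B' \<Longrightarrow> f \<boxtimes> g \<in> hom C (A \<otimes> A') (B \<otimes> B')"
    and TensorA_Id: "A \<in> Obj C \<Longrightarrow> B \<in> Obj C \<Longrightarrow> Id C A \<boxtimes> Id C B = Id C (A \<otimes> B)"
    and TensorA_Comp:
      "f \<in> hom C A B \<Longrightarrow> g \<in> hom C B D \<Longrightarrow> f' \<in> hom C A' B' \<Longrightarrow> g' \<in> hom C B' D' \<Longrightarrow>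
       (g \<cdot> f) \<boxtimes> (g' \<cdot> f') = (g \<boxtimes> g') \<cdot> (f \<boxtimes> f')"
    and Assoc_hom: "X \<in> Obj C \<Longrightarrow> Y \<in> Obj C \<Longrightarrow> Z \<in> Obj C \<Longrightarrow>
       Assoc C X Y Z \<in> hom C ((X \<otimes> Y) \<otimes> Z) (X \<otimes> (Y \<otimes> Z))"
    and LUnit_hom: "X \<in> Obj C \<Longrightarrow> LUnit C X \<in> hom C (\<one> \<otimes> X) X"
    and RUnit_hom: "X \<in> Obj C \<Longrightarrow> RUnit C X \<in> hom C (X \<otimes> \<one>) X"
    and Swap_hom: "X \<in> Obj C \<Longrightarrow> Y \<in> Obj C \<Longrightarrow> Swap C X Y \<in> hom C (X \<otimes> Y) (Y \<otimes> X)"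
    and Assoc_iso: "X \<in> Obj C \<Longrightarrow> Y \<in> Obj C \<Longrightarrow> Z \<in> Obj C \<Longrightarrow> iso C (Assoc C X Y Z)"
    and LUnit_iso: "X \<in> Obj C \<Longrightarrow> iso C (LUnit C X)"
    and RUnit_iso: "X \<in> Obj C \<Longrightarrow> iso C (RUnit C X)"
    and Assoc_natural:
      "f \<in> hom C X X' \<Longrightarrow> g \<in> hom C Y Y' \<Longrightarrow> h \<in> hom C Z Z' \<Longrightarrow>
       Assoc C X' Y' Z' \<cdot> ((f \<boxtimes> g) \<boxtimes> h) = (f \<boxtimes> (g \<boxtimes> h)) \<cdot> Assoc C X Y Z"
    and LUnit_natural: "f \<in> hom C X Y \<Longrightarrow> LUnit C Y \<cdot> (Id C \<one> \<boxtimes> f) = f \<cdot> LUnit C X"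
    and RUnit_natural: "f \<in> hom C X Y \<Longrightarrow> RUnit C Y \<cdot> (f \<boxtimes> Id C \<one>) = f \<cdot> RUnit C X"
    and Swap_natural: "f \<in> hom C X X' \<Longrightarrow> g \<in> hom C Y Y' \<Longrightarrow>
       Swap C X' Y' \<cdot> (f \<boxtimes> g) = (g \<boxtimes> f) \<cdot> Swap C X Y"
    and pentagon: "W \<in> Obj C \<Longrightarrow> X \<in> Obj C \<Longrightarrow> Y \<in> Obj C \<Longrightarrow> Z \<in> Obj C \<Longrightarrow>
       Assoc C W X (Y \<otimes> Z) \<cdot> Assoc C (W \<otimes> X) Y Z =
       (Id C W \<boxtimes> Assoc C X Y Z) \<cdot> Assoc C W (X \<otimes> Y) Z \<cdot> (Assoc C W X Y \<boxtimes> Id C Z)"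
    and triangle: "X \<in> Obj C \<Longrightarrow> Y \<in> Obj C \<Longrightarrow>
       (Id C X \<boxtimes> LUnit C Y) \<cdot> Assoc C X \<one> Y = RUnit C X \<boxtimes> Id C Y"
    and hexagon: "X \<in> Obj C \<Longrightarrow> Y \<in> Obj C \<Longrightarrow> Z \<in> Obj C \<Longrightarrow>
       Assoc C Y Z X \<cdot> Swap C X (Y \<otimes> Z) \<cdot> Assoc C X Y Z =
       (Id C Y \<boxtimes> Swap C X Z) \<cdot> Assoc C Y X Z \<cdot> (Swap C X Y \<boxtimes> Id C Z)"
    and Swap_Swap: "X \<in> Obj C \<Longrightarrow> Y \<in> Obj C \<Longrightarrow> Swap C Y X \<cdot> Swap C X Y = Id C (X \<otimes> Y)"

text \<open>The canonical arrow from \<open>(X \<otimes> Y) \<otimes> (Z \<otimes> W)\<close> to \<open>(X \<otimes> Z) \<otimes> (Y \<otimes> W)\<close>.\<close>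

definition middle_swap :: "('o, 'm, 'z) smc_scheme \<Rightarrow> 'o \<Rightarrow> 'o \<Rightarrow> 'o \<Rightarrow> 'o \<Rightarrow> 'm" where
  "middle_swap C X Y Z W =
     inverse_arr C (Assoc C X Z (Y \<otimes>\<^bsub>C\<^esub> W))
     \<cdot>\<^bsub>C\<^esub> (Id C X \<boxtimes>\<^bsub>C\<^esub> (Assoc C Z Y W \<cdot>\<^bsub>C\<^esub> (Swap C Y Z \<boxtimes>\<^bsub>C\<^esub> Id C W) \<cdot>\<^bsub>C\<^esub> inverse_arr C (Assoc C Y Z W)))
     \<cdot>\<^bsub>C\<^esub> Assoc C X Y (Z \<otimes>\<^bsub>C\<^esub> W)"

record ('o, 'm) markov = "('o, 'm) smc" +
  Copy :: "'o \<Rightarrow> 'm"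
  Del :: "'o \<Rightarrow> 'm"

locale markov_category = symmetric_monoidal_category C
  for C :: "('o, 'm, 'z) markov_scheme" (structure) +
  assumes Unit_terminal: "terminal C \<one>"
    and Copy_hom: "X \<in> Obj C \<Longrightarrow> Copy C X \<in> hom C X (X \<otimes> X)"
    and Del_hom: "X \<in> Obj C \<Longrightarrow> Del C X \<in> hom C X \<one>"
    and Copy_coassoc: "X \<in> Obj C \<Longrightarrow>
       Assoc C X X X \<cdot> (Copy C X \<boxtimes> Id C X) \<cdot> Copy C X = (Id C X \<boxtimes> Copy C X) \<cdot> Copy C X"
    and Copy_left_counit:
      "X \<in> Obj C \<Longrightarrow> LUnit C X \<cdot> (Del C X \<boxtimes> Id C X) \<cdot> Copy C X = Id C X"
    and Copy_right_counit:
      "X \<in> Obj C \<Longrightarrow> RUnit C X \<cdot> (Id C X \<boxtimes> Del C X) \<cdot> Copy C X = Id C X"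
    and Copy_commutative: "X \<in> Obj C \<Longrightarrow> Swap C X X \<cdot> Copy C X = Copy C X"
    and Copy_Tensor: "X \<in> Obj C \<Longrightarrow> Y \<in> Obj C \<Longrightarrow>
       Copy C (X \<otimes> Y) = middle_swap C X X Y Y \<cdot> (Copy C X \<boxtimes> Copy C Y)"
    and Del_Tensor: "X \<in> Obj C \<Longrightarrow> Y \<in> Obj C \<Longrightarrow>
       Del C (X \<otimes> Y) = LUnit C \<one> \<cdot> (Del C X \<boxtimes> Del C Y)"
    and Copy_Unit: "Copy C \<one> = inverse_arr C (LUnit C \<one>)"
    and Del_Unit: "Del C \<one> = Id C \<one>"

definition proj1 :: "('o, 'm, 'z) markov_scheme \<Rightarrow> 'o \<Rightarrow> 'o \<Rightarrow> 'm" where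
  "proj1 C X Y = RUnit C X \<cdot>\<^bsub>C\<^esub> (Id C X \<boxtimes>\<^bsub>C\<^esub> Del C Y)"

definition pair :: "('o, 'm, 'z) markov_scheme \<Rightarrow> 'm \<Rightarrow> 'm \<Rightarrow> 'm" where
  "pair C f g = (f \<boxtimes>\<^bsub>C\<^esub> g) \<cdot>\<^bsub>C\<^esub> Copy C (Dom C f)"

text \<open>Triple products are bracketed to the left.\<close>

definition triple :: "('o, 'm, 'z) markov_scheme \<Rightarrow> 'm \<Rightarrow> 'm \<Rightarrow> 'm \<Rightarrow> 'm" where
  "triple C f g h =
     ((f \<boxtimes>\<^bsub>C\<^esub> g) \<boxtimes>\<^bsub>C\<^esub> h) \<cdot>\<^bsub>C\<^esub> ((Copy C (Dom C f) \<boxtimes>\<^bsub>C\<^esub> Id C (Dom C f)) \<cdot>\<^bsub>C\<^esub> Copy C (Dom C f))"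

definition is_conditional ::
    "('o, 'm, 'z) markov_scheme \<Rightarrow> 'o \<Rightarrow> 'o \<Rightarrow> 'o \<Rightarrow> 'm \<Rightarrow> 'm \<Rightarrow> bool" where
  "is_conditional C A X Y f c \<longleftrightarrow>
     c \<in> hom C (X \<otimes>\<^bsub>C\<^esub> A) Y \<and>
     f = (Id C X \<boxtimes>\<^bsub>C\<^esub> c)
         \<cdot>\<^bsub>C\<^esub> Assoc C X X A
         \<cdot>\<^bsub>C\<^esub> (Copy C X \<boxtimes>\<^bsub>C\<^esub> Id C A)
         \<cdot>\<^bsub>C\<^esub> ((proj1 C X Y \<cdot>\<^bsub>C\<^esub> f) \<boxtimes>\<^bsub>C\<^esub> Id C A)
         \<cdot>\<^bsub>C\<^esub> Copy C A"

definition has_conditionals :: "('o, 'm, 'z) markov_scheme \<Rightarrow> bool" where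
  "has_conditionals C \<longleftrightarrow>
     (\<forall>A \<in> Obj C. \<forall>X \<in> Obj C. \<forall>Y \<in> Obj C. \<forall>f \<in> hom C A (X \<otimes>\<^bsub>C\<^esub> Y). \<exists>c. is_conditional C A X Y f c)"

text \<open>Almost sure equality of parallel arrows with respect to a state \<open>p\<close> on their common domain.\<close>

definition ae_eq :: "('o, 'm, 'z) markov_scheme \<Rightarrow> 'm \<Rightarrow> 'm \<Rightarrow> 'm \<Rightarrow> bool" where
  "ae_eq C p f g \<longleftrightarrow>
     pair C (Id C (Dom C f)) f \<cdot>\<^bsub>C\<^esub> p = pair C (Id C (Dom C g)) g \<cdot>\<^bsub>C\<^esub> p"

definition ae_deterministic :: "('o, 'm, 'z) markov_scheme \<Rightarrow> 'm \<Rightarrow> 'm \<Rightarrow> bool" where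
  "ae_deterministic C p f \<longleftrightarrow>
     ae_eq C p (Copy C (Cod C f) \<cdot>\<^bsub>C\<^esub> f) ((f \<boxtimes>\<^bsub>C\<^esub> f) \<cdot>\<^bsub>C\<^esub> Copy C (Dom C f))"

definition ae_class :: "('o, 'm, 'z) markov_scheme \<Rightarrow> 'm \<Rightarrow> 'm \<Rightarrow> 'm set" where
  "ae_class C p f = {f' \<in> hom C (Dom C f) (Cod C f). ae_eq C p f f'}"

text \<open>A probability space is a pair of an object and a state on it. An arrow of \<open>prob_cat C\<close> is a
  triple of its domain, its codomain and an almost sure equality class of arrows of \<open>C\<close>.\<close>

type_synonym ('o, 'm) prob_obj = "'o \<times> 'm"
type_synonym ('o, 'm) prob_arr = "('o, 'm) prob_obj \<times> ('o, 'm) prob_obj \<times> 'm set"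

definition carrier_of :: "('o, 'm) prob_obj \<Rightarrow> 'o" where
  "carrier_of S = fst S"

definition state_of :: "('o, 'm) prob_obj \<Rightarrow> 'm" where
  "state_of S = snd S"

definition prob_dom :: "('o, 'm) prob_arr \<Rightarrow> ('o, 'm) prob_obj" where
  "prob_dom F = fst F"

definition prob_cod :: "('o, 'm) prob_arr \<Rightarrow> ('o, 'm) prob_obj" where
  "prob_cod F = fst (snd F)"

definition reps :: "('o, 'm) prob_arr \<Rightarrow> 'm set" where
  "reps F = snd (snd F)"

definition prob_spaces :: "('o, 'm, 'z) markov_scheme \<Rightarrow> ('o, 'm) prob_obj set" where
  "prob_spaces C = {(W, p). W \<in> Obj C \<and> p \<in> hom C \<one>\<^bsub>C\<^esub> W}"

definition state_preserving ::
    "('o, 'm, 'z) markov_scheme \<Rightarrow> ('o, 'm) prob_obj \<Rightarrow> ('o, 'm) prob_obj \<Rightarrow> 'm set" where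
  "state_preserving C S T =
     {f \<in> hom C (carrier_of S) (carrier_of T). f \<cdot>\<^bsub>C\<^esub> state_of S = state_of T}"

text \<open>The composite of two classes consists of everything almost surely equal to a composite of
  representatives; this is a single class when \<open>C\<close> has conditionals.\<close>

definition prob_cat ::
    "('o, 'm, 'z) markov_scheme \<Rightarrow> (('o, 'm) prob_obj, ('o, 'm) prob_arr) cat" where
  "prob_cat C =
    \<lparr> Obj = prob_spaces C,
      Arr = {(S, T, ae_class C (state_of S) f) | S T f.
               S \<in> prob_spaces C \<and> T \<in> prob_spaces C \<and> f \<in> state_preserving C S T},
      Dom = prob_dom,
      Cod = prob_cod,
      Id = (\<lambda>S. (S, S, ae_class C (state_of S) (Id C (carrier_of S)))),
      Comp = (\<lambda>G F. (prob_dom F, prob_cod G,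
               \<Union>f \<in> reps F. \<Union>g \<in> reps G. ae_class C (state_of (prob_dom F)) (g \<cdot>\<^bsub>C\<^esub> f))) \<rparr>"

definition sample_cat ::
    "('o, 'm, 'z) markov_scheme \<Rightarrow> (('o, 'm) prob_obj, ('o, 'm) prob_arr) cat" where
  "sample_cat C = (prob_cat C)
    \<lparr> Arr := {F \<in> Arr (prob_cat C).
               \<exists>f \<in> reps F. ae_deterministic C (state_of (prob_dom F)) f} \<rparr>"

text \<open>The arrows \<open>\<phi>\<close> and \<open>\<psi>\<close> are arbitrary arrows of \<open>C\<close>. The equation of states is required for
  all representatives of the classes \<open>f\<close>, \<open>d = u f\<close> and \<open>g\<close>.\<close>

definition independent_square ::
    "('o, 'm, 'z) markov_scheme \<Rightarrow> ('o, 'm) prob_arr \<Rightarrow> ('o, 'm) prob_arr \<Rightarrow>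
     ('o, 'm) prob_arr \<Rightarrow> ('o, 'm) prob_arr \<Rightarrow> bool" where
  "independent_square C f g u v \<longleftrightarrow>
     commutative_square (sample_cat C) f g u v \<and>
     (let W = prob_dom f; X = prob_cod f; Y = prob_cod g; Z = prob_cod u;
          d = Comp (sample_cat C) u f
      in \<exists>\<phi> \<in> hom C (carrier_of Z) (carrier_of X). \<exists>\<psi> \<in> hom C (carrier_of Z) (carrier_of Y).
           \<forall>f' \<in> reps f. \<forall>d' \<in> reps d. \<forall>g' \<in> reps g.
             triple C f' d' g' \<cdot>\<^bsub>C\<^esub> state_of W =
             triple C \<phi> (Id C (carrier_of Z)) \<psi> \<cdot>\<^bsub>C\<^esub> state_of Z)"

end

theory Submission
  imports Defs
begin

text \<open>
  Conditioning the joint state \<open>\<langle>f, g\<rangle> p\<^sub>\<Omega>\<close> on its second component gives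
  \<open>\<phi> : Y \<rightarrow> X\<close> with \<open>\<langle>f, g\<rangle> p\<^sub>\<Omega> = \<langle>\<phi>, id\<rangle> p\<^sub>Y\<close> (\<open>regular_conditional\<close>). In the square at hand
  the diagonal \<open>d = u f\<close> is almost surely \<open>g\<close>, so the joint state of \<open>f\<close>, \<open>d\<close>, \<open>g\<close> is that of
  \<open>f\<close>, \<open>g\<close>, \<open>g\<close>. As \<open>g\<close> is almost surely deterministic, listing its outcome twice is the same as
  copying one outcome: \<open>\<langle>f, g, g\<rangle> p\<^sub>\<Omega>\<close> is \<open>\<langle>f, g\<rangle> p\<^sub>\<Omega>\<close> followed by a copy of \<open>Y\<close>, hence equals
  \<open>\<langle>\<phi>, id, id\<rangle> p\<^sub>Y\<close> (\<open>triple_deterministic\<close>). So the square is independent with witnesses \<open>\<phi>\<close> and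
  \<open>\<psi> = id\<close>.

  The equation has to hold for every choice of representatives with one and the same \<open>\<phi>\<close>. That is
  so because the joint state depends only on almost sure equality classes
  (\<open>triple_cong_state\<close>). A representative of \<open>d\<close> is known only to be almost surely equal to \<open>i k\<close>,
  where \<open>k\<close> represents \<open>g\<close> and \<open>i =\<^sub>p id\<close> for the state \<open>p = p\<^sub>Y\<close>; that \<open>i k\<close> is almost surely \<open>k\<close>
  again uses conditionals (\<open>ae_eq_Comp_right\<close>).
\<close>

section \<open>Categories\<close>

text \<open>The axioms are stated with hom-sets, whose endpoints a rewriter cannot guess. In terms of
  \<open>Arr\<close>, \<open>Dom\<close> and \<open>Cod\<close> all side conditions are decided by rewriting, so the axioms below are
  restated in that form and used as conditional rewrite rules.\<close>

context category
begin

lemma hom_iff: "f \<in> hom C A B \<longleftrightarrow> f \<in> Arr C \<and> Dom C f = A \<and> Cod C f = B"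
  by (simp add: hom_def)

lemma Arr_Comp:
  assumes "f \<in> Arr C" "g \<in> Arr C" "Cod C f = Dom C g"
  shows "g \<cdot> f \<in> Arr C" "Dom C (g \<cdot> f) = Dom C f" "Cod C (g \<cdot> f) = Cod C g"
  using assms Comp_hom[of f "Dom C f" "Cod C f" g "Cod C g"] by (auto simp: hom_iff)

lemma Arr_Id:
  assumes "A \<in> Obj C"
  shows "Id C A \<in> Arr C" "Dom C (Id C A) = A" "Cod C (Id C A) = A"
  using Id_hom[OF assms] by (auto simp: hom_iff)

lemmas arrows = Arr_Comp Arr_Id Dom_Obj Cod_Obj

lemma assoc:
  assumes "f \<in> Arr C" "g \<in> Arr C" "h \<in> Arr C" "Cod C f = Dom C g" "Cod C g = Dom C h"
  shows "(h \<cdot> g) \<cdot> f = h \<cdot> (g \<cdot> f)"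
  using assms by (intro Comp_assoc) (auto simp: hom_iff)

lemma unitR: "f \<in> Arr C \<Longrightarrow> Dom C f = A \<Longrightarrow> f \<cdot> Id C A = f"
  by (rule Comp_Id) (simp add: hom_iff)

lemma unitL: "f \<in> Arr C \<Longrightarrow> Cod C f = B \<Longrightarrow> Id C B \<cdot> f = f"
  by (rule Id_Comp) (simp add: hom_iff)

lemma is_inverse_unique:
  assumes "f \<in> Arr C" "is_inverse C f g" "is_inverse C f h"
  shows "g = h"
proof -
  have "g = g \<cdot> (f \<cdot> h)"
    using assms by (simp add: is_inverse_def hom_iff unitR)
  also have "\<dots> = (g \<cdot> f) \<cdot> h"
    using assms by (intro assoc[symmetric]) (auto simp: is_inverse_def hom_iff)
  also have "\<dots> = h"
    using assms by (simp add: is_inverse_def hom_iff unitL)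
  finally show ?thesis .
qed

lemma inverse_arr_is_inverse:
  assumes "iso C f"
  shows "is_inverse C f (inverse_arr C f)"
proof -
  obtain g where g: "is_inverse C f g"
    using assms by (auto simp: iso_def)
  then show ?thesis
    unfolding inverse_arr_def
    by (rule theI) (use assms g is_inverse_unique in \<open>auto simp: iso_def\<close>)
qed

lemma iso_left_cancel:
  assumes "iso C m" "a \<in> hom C A (Dom C m)" "b \<in> hom C A (Dom C m)" "m \<cdot> a = m \<cdot> b"
  shows "a = b"
proof -
  obtain n where m: "m \<in> Arr C"
    and n: "n \<in> Arr C" "Dom C n = Cod C m" "Cod C n = Dom C m" "n \<cdot> m = Id C (Dom C m)"
    using assms(1) by (auto simp: iso_def is_inverse_def hom_iff)
  have "x = n \<cdot> (m \<cdot> x)" if "x \<in> hom C A (Dom C m)" for x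
  proof -
    have "n \<cdot> (m \<cdot> x) = (n \<cdot> m) \<cdot> x"
      using that m n(1-3) by (simp add: hom_iff assoc)
    then show ?thesis
      using that n(4) by (simp add: hom_iff unitL)
  qed
  then show ?thesis
    using assms by metis
qed

end

section \<open>Symmetric monoidal categories\<close>

context symmetric_monoidal_category
begin

lemma Arr_TensorA:
  assumes "f \<in> Arr C" "g \<in> Arr C"
  shows "f \<boxtimes> g \<in> Arr C" "Dom C (f \<boxtimes> g) = Dom C f \<otimes> Dom C g"
    "Cod C (f \<boxtimes> g) = Cod C f \<otimes> Cod C g"
  using assms TensorA_hom[of f "Dom C f" "Cod C f" g "Dom C g" "Cod C g"] by (auto simp: hom_iff)

lemma Arr_Assoc:
  assumes "X \<in> Obj C" "Y \<in> Obj C" "Z \<in> Obj C"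
  shows "Assoc C X Y Z \<in> Arr C" "Dom C (Assoc C X Y Z) = (X \<otimes> Y) \<otimes> Z"
    "Cod C (Assoc C X Y Z) = X \<otimes> (Y \<otimes> Z)"
  using Assoc_hom[OF assms] by (auto simp: hom_iff)

lemma Arr_Swap:
  assumes "X \<in> Obj C" "Y \<in> Obj C"
  shows "Swap C X Y \<in> Arr C" "Dom C (Swap C X Y) = X \<otimes> Y" "Cod C (Swap C X Y) = Y \<otimes> X"
  using Swap_hom[OF assms] by (auto simp: hom_iff)

lemma Arr_LUnit:
  assumes "X \<in> Obj C"
  shows "LUnit C X \<in> Arr C" "Dom C (LUnit C X) = \<one> \<otimes> X" "Cod C (LUnit C X) = X"
  using LUnit_hom[OF assms] by (auto simp: hom_iff)

lemma Arr_RUnit: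
  assumes "X \<in> Obj C"
  shows "RUnit C X \<in> Arr C" "Dom C (RUnit C X) = X \<otimes> \<one>" "Cod C (RUnit C X) = X"
  using RUnit_hom[OF assms] by (auto simp: hom_iff)

lemmas monoidal_arrows = arrows Arr_TensorA Arr_Assoc Arr_Swap Arr_LUnit Arr_RUnit
  Tensor_Obj Unit_Obj

lemma interchange:
  assumes "f \<in> Arr C" "g \<in> Arr C" "f' \<in> Arr C" "g' \<in> Arr C"
    "Cod C f = Dom C g" "Cod C f' = Dom C g'"
  shows "(g \<boxtimes> g') \<cdot> (f \<boxtimes> f') = (g \<cdot> f) \<boxtimes> (g' \<cdot> f')"
  using assms by (intro TensorA_Comp[symmetric]) (auto simp: hom_iff)

lemma interchange_Comp:
  assumes "f \<in> Arr C" "g \<in> Arr C" "f' \<in> Arr C" "g' \<in> Arr C" "k \<in> Arr C"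
    "Cod C f = Dom C g" "Cod C f' = Dom C g'" "Cod C k = Dom C f \<otimes> Dom C f'"
  shows "(g \<boxtimes> g') \<cdot> ((f \<boxtimes> f') \<cdot> k) = ((g \<cdot> f) \<boxtimes> (g' \<cdot> f')) \<cdot> k"
  using assms by (simp add: interchange[symmetric] assoc monoidal_arrows)

end

section \<open>Pairing in Markov categories\<close>

context markov_category
begin

lemma Arr_Copy:
  assumes "X \<in> Obj C"
  shows "Copy C X \<in> Arr C" "Dom C (Copy C X) = X" "Cod C (Copy C X) = X \<otimes> X"
  using Copy_hom[OF assms] by (auto simp: hom_iff)

lemma Arr_Del:
  assumes "X \<in> Obj C"
  shows "Del C X \<in> Arr C" "Dom C (Del C X) = X" "Cod C (Del C X) = \<one>"
  using Del_hom[OF assms] by (auto simp: hom_iff)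

lemma Arr_pair:
  assumes "f \<in> Arr C" "g \<in> Arr C" "Dom C f = Dom C g"
  shows "pair C f g \<in> Arr C" "Dom C (pair C f g) = Dom C g" "Cod C (pair C f g) = Cod C f \<otimes> Cod C g"
  using assms by (simp_all add: pair_def monoidal_arrows Arr_Copy)

lemma Arr_proj1:
  assumes "X \<in> Obj C" "Y \<in> Obj C"
  shows "proj1 C X Y \<in> Arr C" "Dom C (proj1 C X Y) = X \<otimes> Y" "Cod C (proj1 C X Y) = X"
  using assms by (simp_all add: proj1_def monoidal_arrows Arr_Del)

lemmas markov_arrows = monoidal_arrows Arr_Copy Arr_Del Arr_pair Arr_proj1

lemma TensorA_pair:
  assumes "f \<in> hom C A B" "g \<in> hom C A B'" "h \<in> hom C B D" "k \<in> hom C B' D'"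
  shows "(h \<boxtimes> k) \<cdot> pair C f g = pair C (h \<cdot> f) (k \<cdot> g)"
  using assms by (auto simp: hom_iff pair_def markov_arrows interchange_Comp)

text \<open>Pairing is symmetric because copying is commutative.\<close>

lemma Swap_pair:
  assumes "f \<in> hom C A B" "g \<in> hom C A B'"
  shows "Swap C B B' \<cdot> pair C f g = pair C g f"
proof -
  have A: "A \<in> Obj C" "B \<in> Obj C" "B' \<in> Obj C"
    using assms Dom_Obj Cod_Obj by (auto simp: hom_iff)
  have "Swap C B B' \<cdot> pair C f g = (Swap C B B' \<cdot> (f \<boxtimes> g)) \<cdot> Copy C A"
    using assms A by (auto simp: hom_iff pair_def markov_arrows assoc)
  also have "\<dots> = ((g \<boxtimes> f) \<cdot> Swap C A A) \<cdot> Copy C A"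
    using Swap_natural[OF assms] by simp
  also have "\<dots> = (g \<boxtimes> f) \<cdot> (Swap C A A \<cdot> Copy C A)"
    using assms A by (auto simp: hom_iff markov_arrows assoc)
  also have "\<dots> = pair C g f"
    using assms A by (auto simp: hom_iff pair_def Copy_commutative)
  finally show ?thesis .
qed

lemma triple_eq_pair:
  assumes "f \<in> hom C A B" "g \<in> hom C A B'" "h \<in> hom C A B''"
  shows "triple C f g h = pair C (pair C f g) h"
  using assms
  by (auto simp: hom_iff triple_def pair_def markov_arrows interchange_Comp unitR)

text \<open>Pairing is associative because copying is coassociative.\<close>

lemma Assoc_pair:
  assumes "f \<in> hom C A B" "g \<in> hom C A B'" "h \<in> hom C A B''"
  shows "Assoc C B B' B'' \<cdot> pair C (pair C f g) h = pair C f (pair C g h)"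
proof -
  have A: "A \<in> Obj C" "B \<in> Obj C" "B' \<in> Obj C" "B'' \<in> Obj C"
    using assms Dom_Obj Cod_Obj by (auto simp: hom_iff)
  have "Assoc C B B' B'' \<cdot> pair C (pair C f g) h
      = (Assoc C B B' B'' \<cdot> ((f \<boxtimes> g) \<boxtimes> h)) \<cdot> ((Copy C A \<boxtimes> Id C A) \<cdot> Copy C A)"
    using assms A unfolding triple_eq_pair[OF assms, symmetric] triple_def
    by (auto simp: hom_iff markov_arrows assoc)
  also have "\<dots> = ((f \<boxtimes> (g \<boxtimes> h)) \<cdot> Assoc C A A A) \<cdot> ((Copy C A \<boxtimes> Id C A) \<cdot> Copy C A)"
    using Assoc_natural[OF assms] by simp
  also have "\<dots> = (f \<boxtimes> (g \<boxtimes> h)) \<cdot> (Assoc C A A A \<cdot> (Copy C A \<boxtimes> Id C A) \<cdot> Copy C A)"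
    using assms A by (auto simp: hom_iff markov_arrows assoc)
  also have "\<dots> = (f \<boxtimes> (g \<boxtimes> h)) \<cdot> ((Id C A \<boxtimes> Copy C A) \<cdot> Copy C A)"
    using A by (simp add: Copy_coassoc)
  also have "\<dots> = pair C f (pair C g h)"
    using assms A by (auto simp: hom_iff pair_def markov_arrows interchange_Comp unitR)
  finally show ?thesis .
qed

text \<open>Since the unit is terminal, deleting the outcome of \<open>g\<close> deletes \<open>g\<close>; the counit law does the
  rest.\<close>

lemma proj1_pair:
  assumes "f \<in> hom C A B" "g \<in> hom C A B'"
  shows "proj1 C B B' \<cdot> pair C f g = f"
proof -
  have A: "A \<in> Obj C" "B \<in> Obj C" "B' \<in> Obj C"
    using assms Dom_Obj Cod_Obj by (auto simp: hom_iff)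
  have del: "Del C B' \<cdot> g = Del C A"
  proof -
    have "Del C B' \<cdot> g \<in> hom C A \<one>" "Del C A \<in> hom C A \<one>"
      using assms A by (auto simp: hom_iff markov_arrows)
    then show ?thesis
      using Unit_terminal A unfolding terminal_def by blast
  qed
  have "proj1 C B B' \<cdot> pair C f g = RUnit C B \<cdot> ((f \<boxtimes> Del C A) \<cdot> Copy C A)"
    using assms A
    by (auto simp: hom_iff proj1_def pair_def markov_arrows assoc interchange_Comp unitL del)
  also have "\<dots> = (RUnit C B \<cdot> (f \<boxtimes> Id C \<one>)) \<cdot> ((Id C A \<boxtimes> Del C A) \<cdot> Copy C A)"
    using assms A
    by (auto simp: hom_iff markov_arrows assoc interchange_Comp unitL unitR)
  also have "\<dots> = f \<cdot> (RUnit C A \<cdot> (Id C A \<boxtimes> Del C A) \<cdot> Copy C A)"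
    unfolding RUnit_natural[OF assms(1)]
    using assms A by (auto simp: hom_iff markov_arrows assoc)
  also have "\<dots> = f"
    using assms A by (auto simp: hom_iff Copy_right_counit unitR)
  finally show ?thesis .
qed

section \<open>Almost sure equality\<close>

lemma ae_eq_iff:
  assumes "f \<in> hom C A B" "g \<in> hom C A B"
  shows "ae_eq C p f g \<longleftrightarrow> pair C (Id C A) f \<cdot> p = pair C (Id C A) g \<cdot> p"
  using assms by (simp add: ae_eq_def hom_iff)

text \<open>Apply \<open>k \<boxtimes> id\<close> to the equation that defines almost sure equality.\<close>

lemma ae_eq_pair:
  assumes "f \<in> hom C A B" "g \<in> hom C A B" "k \<in> hom C A D" "p \<in> hom C \<one> A" "ae_eq C p f g"
  shows "pair C k f \<cdot> p = pair C k g \<cdot> p"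
proof -
  have A: "A \<in> Obj C" "B \<in> Obj C" "D \<in> Obj C"
    using assms Dom_Obj Cod_Obj by (auto simp: hom_iff)
  have *: "pair C k x \<cdot> p = (k \<boxtimes> Id C B) \<cdot> (pair C (Id C A) x \<cdot> p)" if "x \<in> hom C A B" for x
  proof -
    have "pair C k x = (k \<boxtimes> Id C B) \<cdot> pair C (Id C A) x"
      using TensorA_pair[OF Id_hom that assms(3) Id_hom] that A assms(3)
      by (simp add: Comp_Id Id_Comp)
    then show ?thesis
      using that assms(3,4) A by (auto simp: hom_iff markov_arrows assoc)
  qed
  show ?thesis
    using assms(5) by (simp add: *[OF assms(1)] *[OF assms(2)] ae_eq_iff[OF assms(1,2)])
qed

text \<open>By associativity \<open>\<langle>id, \<langle>k, f\<rangle>\<rangle>\<close> is \<open>\<langle>\<langle>id, k\<rangle>, f\<rangle>\<close> up to a coherence arrow, and in the latter \<open>f\<close>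
  can be replaced.\<close>

lemma ae_eq_pair_right:
  assumes "f \<in> hom C A B" "g \<in> hom C A B" "k \<in> hom C A D" "p \<in> hom C \<one> A" "ae_eq C p f g"
  shows "ae_eq C p (pair C k f) (pair C k g)"
proof -
  have A: "A \<in> Obj C" "B \<in> Obj C" "D \<in> Obj C"
    using assms Dom_Obj Cod_Obj by (auto simp: hom_iff)
  have *: "pair C (Id C A) (pair C k x) \<cdot> p = Assoc C A D B \<cdot> (pair C (pair C (Id C A) k) x \<cdot> p)"
    if "x \<in> hom C A B" for x
    using Assoc_pair[OF Id_hom assms(3) that, symmetric] that assms(3,4) A
    by (auto simp: hom_iff markov_arrows assoc)
  have "pair C (pair C (Id C A) k) f \<cdot> p = pair C (pair C (Id C A) k) g \<cdot> p"
    by (rule ae_eq_pair[OF assms(1,2) _ assms(4,5)])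
      (use A assms(3) in \<open>auto simp: hom_iff markov_arrows\<close>)
  then show ?thesis
    using *[OF assms(1)] *[OF assms(2)] assms A
    by (subst ae_eq_iff[where A = A and B = "D \<otimes> B"]) (auto simp: hom_iff markov_arrows)
qed

lemma ae_eq_Comp_left:
  assumes "f \<in> hom C A B" "g \<in> hom C A B" "h \<in> hom C B D" "p \<in> hom C \<one> A" "ae_eq C p f g"
  shows "ae_eq C p (h \<cdot> f) (h \<cdot> g)"
proof -
  have A: "A \<in> Obj C" "B \<in> Obj C" "D \<in> Obj C"
    using assms Dom_Obj Cod_Obj by (auto simp: hom_iff)
  have *: "pair C (Id C A) (h \<cdot> x) \<cdot> p = (Id C A \<boxtimes> h) \<cdot> (pair C (Id C A) x \<cdot> p)"
    if "x \<in> hom C A B" for x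
  proof -
    have "pair C (Id C A) (h \<cdot> x) = (Id C A \<boxtimes> h) \<cdot> pair C (Id C A) x"
      using TensorA_pair[OF Id_hom that Id_hom assms(3)] A by (simp add: Arr_Id unitL)
    then show ?thesis
      using that assms(3,4) A by (auto simp: hom_iff markov_arrows assoc)
  qed
  show ?thesis
    using *[OF assms(1)] *[OF assms(2)] assms A ae_eq_iff[OF assms(1,2)]
    by (subst ae_eq_iff[where A = A and B = D]) (auto simp: hom_iff markov_arrows)
qed

text \<open>The second component is replaced directly, the first one after a swap.\<close>

lemma ae_eq_pair_cong:
  assumes "f \<in> hom C A B" "f' \<in> hom C A B" "g \<in> hom C A D" "g' \<in> hom C A D"
    and p: "p \<in> hom C \<one> A" and "ae_eq C p f f'" "ae_eq C p g g'"
  shows "ae_eq C p (pair C f g) (pair C f' g')"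
proof -
  have A: "A \<in> Obj C" "B \<in> Obj C" "D \<in> Obj C"
    using assms Dom_Obj Cod_Obj by (auto simp: hom_iff)
  have "ae_eq C p (Swap C D B \<cdot> pair C g f) (Swap C D B \<cdot> pair C g f')"
    by (rule ae_eq_Comp_left[OF _ _ _ p ae_eq_pair_right[OF assms(1,2,3) p assms(6)]])
      (use A assms in \<open>auto simp: hom_iff markov_arrows\<close>)
  then have "ae_eq C p (pair C f g) (pair C f' g)"
    using Swap_pair[OF assms(3,1)] Swap_pair[OF assms(3,2)] by simp
  moreover have "ae_eq C p (pair C f' g) (pair C f' g')"
    by (rule ae_eq_pair_right[OF assms(3,4,2) p assms(7)])
  ultimately show ?thesis
    by (simp add: ae_eq_def)
qed

text \<open>Marginalise the defining equation of almost sure equality to the second factor.\<close>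

lemma ae_eq_pushforward:
  assumes "f \<in> hom C A B" "g \<in> hom C A B" "p \<in> hom C \<one> A" "ae_eq C p f g"
  shows "f \<cdot> p = g \<cdot> p"
proof -
  have A: "A \<in> Obj C" "B \<in> Obj C"
    using assms Dom_Obj Cod_Obj by (auto simp: hom_iff)
  have *: "x \<cdot> p = (proj1 C B A \<cdot> Swap C A B) \<cdot> (pair C (Id C A) x \<cdot> p)" if x: "x \<in> hom C A B" for x
  proof -
    have "x = proj1 C B A \<cdot> (Swap C A B \<cdot> pair C (Id C A) x)"
      using Swap_pair[OF Id_hom x] proj1_pair[OF x Id_hom] A by simp
    also have "\<dots> \<cdot> p = (proj1 C B A \<cdot> Swap C A B) \<cdot> (pair C (Id C A) x \<cdot> p)"
      using x assms(3) A by (auto simp: hom_iff markov_arrows assoc)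
    finally show ?thesis .
  qed
  show ?thesis
    using *[OF assms(1)] *[OF assms(2)] assms(4) ae_eq_iff[OF assms(1,2)] by metis
qed

lemma ae_eq_pair_state:
  assumes "f \<in> hom C A B" "f' \<in> hom C A B" "g \<in> hom C A D" "g' \<in> hom C A D"
    and p: "p \<in> hom C \<one> A" and "ae_eq C p f f'" "ae_eq C p g g'"
  shows "pair C f g \<cdot> p = pair C f' g' \<cdot> p"
  by (rule ae_eq_pushforward[OF _ _ p ae_eq_pair_cong[OF assms]])
    (use assms in \<open>auto simp: hom_iff markov_arrows\<close>)

lemma triple_cong_state:
  assumes "f \<in> hom C A B" "f' \<in> hom C A B" "g \<in> hom C A D" "g' \<in> hom C A D"
    "h \<in> hom C A E" "h' \<in> hom C A E" "p \<in> hom C \<one> A"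
    "ae_eq C p f f'" "ae_eq C p g g'" "ae_eq C p h h'"
  shows "triple C f g h \<cdot> p = triple C f' g' h' \<cdot> p"
  unfolding triple_eq_pair[OF assms(1,3,5)] triple_eq_pair[OF assms(2,4,6)]
  by (rule ae_eq_pair_state[OF _ _ assms(5,6,7) ae_eq_pair_cong[OF assms(1-4,7-9)] assms(10)])
    (use assms in \<open>auto simp: hom_iff markov_arrows\<close>)

section \<open>Conditionals\<close>

text \<open>Both sides become \<open>t\<close> under the right unitor: the left one by the counit law, the right one by
  naturality.\<close>

lemma pair_Del_state:
  assumes "t \<in> hom C \<one> A"
  shows "(Id C A \<boxtimes> Del C A) \<cdot> Copy C A \<cdot> t = (t \<boxtimes> Id C \<one>) \<cdot> Copy C \<one>"
proof -
  have A: "A \<in> Obj C"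
    using assms Cod_Obj by (auto simp: hom_iff)
  have I: "is_inverse C (LUnit C \<one>) (Copy C \<one>)"
    unfolding Copy_Unit by (intro inverse_arr_is_inverse LUnit_iso Unit_Obj)
  \<comment> \<open>The two unitors on the unit are parallel arrows into a terminal object.\<close>
  have RL: "RUnit C \<one> = LUnit C \<one>"
    using Unit_terminal LUnit_hom[OF Unit_Obj] RUnit_hom[OF Unit_Obj]
      Tensor_Obj[OF Unit_Obj Unit_Obj]
    unfolding terminal_def by blast
  have 1: "RUnit C A \<cdot> ((Id C A \<boxtimes> Del C A) \<cdot> Copy C A \<cdot> t) = t"
  proof -
    have "RUnit C A \<cdot> ((Id C A \<boxtimes> Del C A) \<cdot> Copy C A \<cdot> t)
        = (RUnit C A \<cdot> (Id C A \<boxtimes> Del C A) \<cdot> Copy C A) \<cdot> t"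
      using A assms by (auto simp: hom_iff markov_arrows assoc)
    then show ?thesis
      using A assms by (simp add: Copy_right_counit Id_Comp)
  qed
  have 2: "RUnit C A \<cdot> ((t \<boxtimes> Id C \<one>) \<cdot> Copy C \<one>) = t"
  proof -
    have "RUnit C A \<cdot> ((t \<boxtimes> Id C \<one>) \<cdot> Copy C \<one>) = (RUnit C A \<cdot> (t \<boxtimes> Id C \<one>)) \<cdot> Copy C \<one>"
      using A assms by (auto simp: hom_iff markov_arrows assoc)
    also have "\<dots> = t \<cdot> (LUnit C \<one> \<cdot> Copy C \<one>)"
      unfolding RUnit_natural[OF assms] RL
      using A assms by (auto simp: hom_iff markov_arrows assoc)
    also have "\<dots> = t"
      using I assms by (auto simp: is_inverse_def Arr_LUnit[OF Unit_Obj] hom_iff unitR)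
    finally show ?thesis .
  qed
  show ?thesis
    by (rule iso_left_cancel[OF RUnit_iso[OF A], where A = \<one>])
      (use A assms 1 2 in \<open>auto simp: hom_iff markov_arrows\<close>)
qed

text \<open>The case of a conditional whose input is the unit: the conditional has domain \<open>A \<otimes> \<one>\<close>, and the
  superfluous unit factor is produced by deleting a copy of \<open>A\<close>.\<close>

lemma state_disintegration:
  assumes "has_conditionals C" "A \<in> Obj C" "B \<in> Obj C" "s \<in> hom C \<one> (A \<otimes> B)"
  obtains h where "h \<in> hom C A B" "s = pair C (Id C A) h \<cdot> (proj1 C A B \<cdot> s)"
proof -
  note A = assms(2,3) Unit_Obj
  obtain c where "is_conditional C \<one> A B s c"
    using assms Unit_Obj unfolding has_conditionals_def by blast
  then have c: "c \<in> Arr C" "Dom C c = A \<otimes> \<one>" "Cod C c = B"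
    and s: "s = (Id C A \<boxtimes> c) \<cdot> Assoc C A A \<one> \<cdot> (Copy C A \<boxtimes> Id C \<one>)
        \<cdot> ((proj1 C A B \<cdot> s) \<boxtimes> Id C \<one>) \<cdot> Copy C \<one>"
    by (auto simp: is_conditional_def hom_iff)
  define t where "t = proj1 C A B \<cdot> s"
  have t: "t \<in> Arr C" "Dom C t = \<one>" "Cod C t = A" and t': "t \<in> hom C \<one> A"
    using assms(4) A by (auto simp: t_def hom_iff markov_arrows)
  \<comment> \<open>Using \<open>\<langle>id, del\<rangle>\<close> in place of the inverse unitor reduces the bookkeeping of units to
    coassociativity and the counit law.\<close>
  define h where "h = c \<cdot> pair C (Id C A) (Del C A)"
  have "s = (Id C A \<boxtimes> c) \<cdot> Assoc C A A \<one> \<cdot> (Copy C A \<boxtimes> Id C \<one>) \<cdot> (t \<boxtimes> Id C \<one>) \<cdot> Copy C \<one>"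
    using s unfolding t_def .
  also have "\<dots> = (Id C A \<boxtimes> c) \<cdot> (Assoc C A A \<one> \<cdot> ((Copy C A \<boxtimes> Id C \<one>) \<cdot> ((t \<boxtimes> Id C \<one>) \<cdot> Copy C \<one>)))"
    using A c t by (simp add: markov_arrows assoc)
  also have "\<dots> = (Id C A \<boxtimes> c) \<cdot> (Assoc C A A \<one> \<cdot> ((Copy C A \<boxtimes> Id C \<one>) \<cdot>
      ((Id C A \<boxtimes> Del C A) \<cdot> Copy C A \<cdot> t)))"
    unfolding pair_Del_state[OF t'] ..
  also have "\<dots> = (Id C A \<boxtimes> c) \<cdot> (Assoc C A A \<one> \<cdot> pair C (pair C (Id C A) (Id C A)) (Del C A)) \<cdot> t"
    using A c t
    by (simp add: markov_arrows assoc pair_def interchange_Comp unitL unitR TensorA_Id)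
  also have "\<dots> = (Id C A \<boxtimes> c) \<cdot> pair C (Id C A) (pair C (Id C A) (Del C A)) \<cdot> t"
    using Assoc_pair[OF Id_hom Id_hom Del_hom, of A] A by simp
  also have "\<dots> = pair C (Id C A) h \<cdot> t"
  proof -
    have "(Id C A \<boxtimes> c) \<cdot> pair C (Id C A) (pair C (Id C A) (Del C A)) = pair C (Id C A \<cdot> Id C A) h"
      unfolding h_def
      by (rule TensorA_pair) (use A c in \<open>auto simp: hom_iff markov_arrows\<close>)
    then show ?thesis
      using A by (simp add: unitL Arr_Id)
  qed
  finally have "s = pair C (Id C A) h \<cdot> (proj1 C A B \<cdot> s)"
    unfolding t_def .
  moreover have "h \<in> hom C A B"
    using A c by (simp add: h_def hom_iff markov_arrows)
  ultimately show ?thesis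
    using that by blast
qed

text \<open>The regular conditional distribution of \<open>f\<close> given \<open>g\<close>. Disintegration conditions on the first
  factor, so it is applied to \<open>\<langle>g, f\<rangle> p\<close> and the result is swapped. For \<open>f = id\<close> this is the
  Bayesian inverse of \<open>g\<close>.\<close>

lemma regular_conditional:
  assumes "has_conditionals C" "f \<in> hom C A B" "g \<in> hom C A D" "p \<in> hom C \<one> A"
  obtains \<phi> where "\<phi> \<in> hom C D B" "pair C f g \<cdot> p = pair C \<phi> (Id C D) \<cdot> (g \<cdot> p)"
proof -
  have A: "A \<in> Obj C" "B \<in> Obj C" "D \<in> Obj C"
    using assms Dom_Obj Cod_Obj by (auto simp: hom_iff)
  have "pair C g f \<cdot> p \<in> hom C \<one> (D \<otimes> B)"
    using assms A by (auto simp: hom_iff markov_arrows)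
  then obtain \<phi> where \<phi>: "\<phi> \<in> hom C D B"
    and eq: "pair C g f \<cdot> p = pair C (Id C D) \<phi> \<cdot> (proj1 C D B \<cdot> (pair C g f \<cdot> p))"
    using state_disintegration[OF assms(1) A(3,2)] by metis
  have "proj1 C D B \<cdot> (pair C g f \<cdot> p) = (proj1 C D B \<cdot> pair C g f) \<cdot> p"
    using assms A by (auto simp: hom_iff markov_arrows assoc)
  then have eq: "pair C g f \<cdot> p = pair C (Id C D) \<phi> \<cdot> (g \<cdot> p)"
    using eq proj1_pair[OF assms(3,2)] by simp
  have "pair C f g \<cdot> p = Swap C D B \<cdot> (pair C g f \<cdot> p)"
    unfolding Swap_pair[OF assms(3,2), symmetric]
    using assms A by (auto simp: hom_iff markov_arrows assoc)
  also have "\<dots> = (Swap C D B \<cdot> pair C (Id C D) \<phi>) \<cdot> (g \<cdot> p)"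
    unfolding eq using assms A \<phi> by (auto simp: hom_iff markov_arrows assoc)
  also have "\<dots> = pair C \<phi> (Id C D) \<cdot> (g \<cdot> p)"
    unfolding Swap_pair[OF Id_hom[OF A(3)] \<phi>] ..
  finally show ?thesis
    using that \<phi> by blast
qed

text \<open>With the Bayesian inverse \<open>h\<close> of \<open>g\<close>, the joint state \<open>\<langle>id, x g\<rangle> p\<close> is \<open>\<langle>h, x\<rangle> (g p)\<close>, which
  depends only on the almost sure class of \<open>x\<close> for the state \<open>g p\<close>.\<close>

lemma ae_eq_Comp_right:
  assumes "has_conditionals C" "g \<in> hom C A B" "i \<in> hom C B D" "j \<in> hom C B D" "p \<in> hom C \<one> A"
    and ae: "ae_eq C (g \<cdot> p) i j"
  shows "ae_eq C p (i \<cdot> g) (j \<cdot> g)"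
proof -
  have A: "A \<in> Obj C" "B \<in> Obj C" "D \<in> Obj C"
    using assms Dom_Obj Cod_Obj by (auto simp: hom_iff)
  obtain h where h: "h \<in> hom C B A"
    and eq: "pair C (Id C A) g \<cdot> p = pair C h (Id C B) \<cdot> (g \<cdot> p)"
    using regular_conditional[OF assms(1) Id_hom[OF A(1)] assms(2,5)] by metis
  have *: "pair C (Id C A) (x \<cdot> g) \<cdot> p = pair C h x \<cdot> (g \<cdot> p)" if x: "x \<in> hom C B D" for x
  proof -
    have "pair C (Id C A) (x \<cdot> g) \<cdot> p = ((Id C A \<boxtimes> x) \<cdot> pair C (Id C A) g) \<cdot> p"
      using TensorA_pair[OF Id_hom assms(2) Id_hom x] A by (simp add: Arr_Id unitL)
    also have "\<dots> = (Id C A \<boxtimes> x) \<cdot> (pair C h (Id C B) \<cdot> (g \<cdot> p))"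
      unfolding eq[symmetric] using x assms A by (auto simp: hom_iff markov_arrows assoc)
    also have "\<dots> = ((Id C A \<boxtimes> x) \<cdot> pair C h (Id C B)) \<cdot> (g \<cdot> p)"
      using x assms A h by (auto simp: hom_iff markov_arrows assoc)
    also have "(Id C A \<boxtimes> x) \<cdot> pair C h (Id C B) = pair C h x"
      using TensorA_pair[OF h Id_hom Id_hom x] A x h by (simp add: Id_Comp Comp_Id)
    finally show ?thesis .
  qed
  have "pair C h i \<cdot> (g \<cdot> p) = pair C h j \<cdot> (g \<cdot> p)"
    by (rule ae_eq_pair[OF assms(3,4) h _ ae]) (use assms in \<open>auto simp: hom_iff markov_arrows\<close>)
  then show ?thesis
    using *[OF assms(3)] *[OF assms(4)] assms
    by (subst ae_eq_iff[where A = A and B = D]) (auto simp: hom_iff markov_arrows)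
qed

text \<open>Determinism turns \<open>\<langle>f, \<langle>g, g\<rangle>\<rangle> p\<close> into \<open>\<langle>f, copy g\<rangle> p = (id \<boxtimes> copy) \<langle>f, g\<rangle> p\<close>. The factor
  \<open>\<langle>f, g\<rangle> p\<close> can then be replaced by \<open>\<langle>\<phi>, id\<rangle> (g p)\<close>.\<close>

lemma triple_deterministic:
  assumes "f \<in> hom C A B" "g \<in> hom C A D" "p \<in> hom C \<one> A" "ae_deterministic C p g"
    and \<phi>: "\<phi> \<in> hom C D B" and eq: "pair C f g \<cdot> p = pair C \<phi> (Id C D) \<cdot> (g \<cdot> p)"
  shows "triple C f g g \<cdot> p = triple C \<phi> (Id C D) (Id C D) \<cdot> (g \<cdot> p)"
proof -
  have A: "A \<in> Obj C" "B \<in> Obj C" "D \<in> Obj C"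
    using assms Dom_Obj Cod_Obj by (auto simp: hom_iff)
  have ae: "ae_eq C p (Copy C D \<cdot> g) (pair C g g)"
    using assms(2,4) by (simp add: ae_deterministic_def pair_def hom_iff)
  have copy: "pair C (Id C D) (Id C D) = Copy C D"
    using A by (simp add: pair_def TensorA_Id markov_arrows unitL)
  have "Assoc C B D D \<cdot> (triple C f g g \<cdot> p) = (Assoc C B D D \<cdot> pair C (pair C f g) g) \<cdot> p"
    using assms A unfolding triple_eq_pair[OF assms(1,2,2)]
    by (auto simp: hom_iff markov_arrows assoc)
  also have "\<dots> = pair C f (pair C g g) \<cdot> p"
    unfolding Assoc_pair[OF assms(1,2,2)] ..
  also have "\<dots> = pair C f (Copy C D \<cdot> g) \<cdot> p"
    by (rule ae_eq_pair[OF _ _ assms(1,3) ae, symmetric])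
      (use assms A in \<open>auto simp: hom_iff markov_arrows\<close>)
  also have "\<dots> = ((Id C B \<boxtimes> Copy C D) \<cdot> pair C f g) \<cdot> p"
    using TensorA_pair[OF assms(1,2) Id_hom Copy_hom] A assms(1) by (simp add: Id_Comp)
  also have "\<dots> = (Id C B \<boxtimes> Copy C D) \<cdot> (pair C \<phi> (Id C D) \<cdot> (g \<cdot> p))"
    unfolding eq[symmetric] using assms A by (auto simp: hom_iff markov_arrows assoc)
  also have "\<dots> = ((Id C B \<boxtimes> Copy C D) \<cdot> pair C \<phi> (Id C D)) \<cdot> (g \<cdot> p)"
    using assms A by (auto simp: hom_iff markov_arrows assoc)
  also have "\<dots> = pair C \<phi> (pair C (Id C D) (Id C D)) \<cdot> (g \<cdot> p)"
    using TensorA_pair[OF \<phi> Id_hom Id_hom Copy_hom] A \<phi>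
    by (simp add: Id_Comp markov_arrows unitR copy)
  also have "\<dots> = (Assoc C B D D \<cdot> pair C (pair C \<phi> (Id C D)) (Id C D)) \<cdot> (g \<cdot> p)"
    using Assoc_pair[OF \<phi> Id_hom Id_hom] A by simp
  also have "\<dots> = Assoc C B D D \<cdot> (triple C \<phi> (Id C D) (Id C D) \<cdot> (g \<cdot> p))"
    using assms A unfolding triple_eq_pair[OF \<phi> Id_hom[OF A(3)] Id_hom[OF A(3)]]
    by (auto simp: hom_iff markov_arrows assoc)
  finally have *: "Assoc C B D D \<cdot> (triple C f g g \<cdot> p)
      = Assoc C B D D \<cdot> (triple C \<phi> (Id C D) (Id C D) \<cdot> (g \<cdot> p))" .
  show ?thesis
    by (rule iso_left_cancel[OF Assoc_iso[OF A(2,3,3)] _ _ *, where A = \<one>])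
      (use assms A in \<open>auto simp: hom_iff triple_eq_pair[OF assms(1,2,2)]
        triple_eq_pair[OF \<phi> Id_hom[OF A(3)] Id_hom[OF A(3)]] markov_arrows\<close>)
qed

section \<open>Sample spaces\<close>

text \<open>Determinism is asserted of some representative only. That representative preserves the states
  and generates the class, so it can be taken as the representative throughout.\<close>

lemma sample_hom_cases:
  assumes "F \<in> hom (sample_cat C) S T"
  obtains f where "S \<in> prob_spaces C" "T \<in> prob_spaces C" "f \<in> state_preserving C S T"
    "F = (S, T, ae_class C (state_of S) f)"
    "f \<in> reps F" "ae_deterministic C (state_of S) f"
proof -
  from assms obtain f0 f where 0: "S \<in> prob_spaces C" "T \<in> prob_spaces C" "f0 \<in> state_preserving C S T"
    "F = (S, T, ae_class C (state_of S) f0)"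
    and f: "f \<in> reps F" "ae_deterministic C (state_of S) f"
    by (auto simp: hom_def sample_cat_def prob_cat_def prob_dom_def prob_cod_def reps_def)
  have f0: "f0 \<in> hom C (carrier_of S) (carrier_of T)" "f0 \<cdot> state_of S = state_of T"
    using 0(3) by (auto simp: state_preserving_def)
  have f': "f \<in> hom C (carrier_of S) (carrier_of T)" "ae_eq C (state_of S) f0 f"
    using f(1) f0 0(4) by (auto simp: ae_class_def reps_def hom_iff)
  have p: "state_of S \<in> hom C \<one> (carrier_of S)"
    using 0(1) by (auto simp: prob_spaces_def carrier_of_def state_of_def)
  have "f \<cdot> state_of S = state_of T"
    using ae_eq_pushforward[OF f0(1) f'(1) p f'(2)] f0(2) by simp
  then have 1: "f \<in> state_preserving C S T"
    using f' by (simp add: state_preserving_def)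
  have "ae_class C (state_of S) f0 = ae_class C (state_of S) f"
    using f0 f' by (auto simp: ae_class_def ae_eq_def hom_iff)
  then show ?thesis
    using that 0 1 f by simp
qed

lemma Id_sample_hom:
  assumes "S \<in> prob_spaces C"
  shows "Id (sample_cat C) S \<in> hom (sample_cat C) S S"
proof -
  have S: "carrier_of S \<in> Obj C" "state_of S \<in> hom C \<one> (carrier_of S)"
    using assms by (auto simp: prob_spaces_def carrier_of_def state_of_def)
  have "Id C (carrier_of S) \<in> state_preserving C S S"
    using S by (simp add: state_preserving_def Id_hom Id_Comp)
  moreover have "Id C (carrier_of S) \<in> ae_class C (state_of S) (Id C (carrier_of S))"
    using S by (simp add: ae_class_def ae_eq_def hom_iff Arr_Id)
  moreover have "ae_deterministic C (state_of S) (Id C (carrier_of S))"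
    using S by (simp add: ae_deterministic_def ae_eq_def markov_arrows TensorA_Id unitL unitR)
  ultimately show ?thesis
    using assms
    by (cases S) (auto simp: hom_def sample_cat_def prob_cat_def prob_dom_def prob_cod_def reps_def)
qed

text \<open>The left unit law of \<open>prob_cat C\<close>, on representatives: composing with the identity class does
  not enlarge a class. It needs conditionals, because the
  identity class contains arrows that are only almost surely the identity.\<close>

lemma reps_Id_Comp:
  assumes "has_conditionals C" "S \<in> prob_spaces C" "g \<in> state_preserving C S T"
    and G: "G = (S, T, ae_class C (state_of S) g)"
    and d: "d \<in> reps (Comp (sample_cat C) (Id (sample_cat C) T) G)"
  shows "d \<in> hom C (carrier_of S) (carrier_of T)" "ae_eq C (state_of S) d g"
proof -
  let ?A = "carrier_of S" and ?B = "carrier_of T" and ?p = "state_of S"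
  have g: "g \<in> hom C ?A ?B" "g \<cdot> ?p = state_of T"
    using assms(3) by (auto simp: state_preserving_def)
  have p: "?p \<in> hom C \<one> ?A"
    using assms(2) by (auto simp: prob_spaces_def carrier_of_def state_of_def)
  have B: "?B \<in> Obj C"
    using g(1) Cod_Obj[of g] by (simp add: hom_iff)
  obtain k i where k: "k \<in> ae_class C ?p g" and i: "i \<in> ae_class C (state_of T) (Id C ?B)"
    and d': "d \<in> ae_class C ?p (i \<cdot> k)"
    using d by (auto simp: G reps_def sample_cat_def prob_cat_def prob_dom_def)
  have k: "k \<in> hom C ?A ?B" "ae_eq C ?p g k"
    using k g by (auto simp: ae_class_def hom_iff)
  have i: "i \<in> hom C ?B ?B" "ae_eq C (state_of T) (Id C ?B) i"
    using i B by (auto simp: ae_class_def hom_iff Arr_Id)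
  have ik: "i \<cdot> k \<in> hom C ?A ?B"
    by (rule Comp_hom[OF k(1) i(1)])
  have d': "d \<in> hom C ?A ?B" "ae_eq C ?p (i \<cdot> k) d"
    using d' ik by (auto simp: ae_class_def hom_iff)
  have "k \<cdot> ?p = state_of T"
    using ae_eq_pushforward[OF g(1) k(1) p k(2)] g(2) by simp
  then have "ae_eq C ?p (Id C ?B \<cdot> k) (i \<cdot> k)"
    using ae_eq_Comp_right[OF assms(1) k(1) Id_hom[OF B] i(1) p] i(2) by simp
  then have "ae_eq C ?p k (i \<cdot> k)"
    using k(1) by (simp add: Id_Comp)
  then show "ae_eq C ?p d g"
    using k(2) d'(2) by (simp add: ae_eq_def)
  show "d \<in> hom C ?A ?B"
    by (rule d'(1))
qed

end

section \<open>Independence of the square\<close>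

theorem proposition16:
  fixes C :: "('o, 'm, 'z) markov_scheme"
    and \<Omega> X Y :: "('o, 'm) prob_obj"
    and f g u :: "('o, 'm) prob_arr"
  assumes "markov_category C"
    and "has_conditionals C"
    and "f \<in> hom (sample_cat C) \<Omega> X"
    and "g \<in> hom (sample_cat C) \<Omega> Y"
    and "u \<in> hom (sample_cat C) X Y"
    and "Comp (sample_cat C) u f = Comp (sample_cat C) (Id (sample_cat C) Y) g"
  shows "independent_square C f g u (Id (sample_cat C) Y)"
proof -
  interpret markov_category C by fact
  let ?A = "carrier_of \<Omega>" and ?B = "carrier_of X" and ?D = "carrier_of Y" and ?p = "state_of \<Omega>"
  obtain f0 where \<Omega>: "\<Omega> \<in> prob_spaces C" and f0: "f0 \<in> state_preserving C \<Omega> X"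
    and f: "f = (\<Omega>, X, ae_class C ?p f0)"
    using sample_hom_cases[OF assms(3)] by metis
  obtain g0 where Y: "Y \<in> prob_spaces C" and g0: "g0 \<in> state_preserving C \<Omega> Y"
    and g: "g = (\<Omega>, Y, ae_class C ?p g0)" and det: "ae_deterministic C ?p g0"
    using sample_hom_cases[OF assms(4)] by metis
  have p: "?p \<in> hom C \<one>\<^bsub>C\<^esub> ?A"
    using \<Omega> by (auto simp: prob_spaces_def carrier_of_def state_of_def)
  have f0: "f0 \<in> hom C ?A ?B"
    using f0 by (simp add: state_preserving_def)
  have g0': "g0 \<in> hom C ?A ?D" "g0 \<cdot>\<^bsub>C\<^esub> ?p = state_of Y"
    using g0 by (auto simp: state_preserving_def)
  have D: "?D \<in> Obj C"
    using Y by (auto simp: prob_spaces_def carrier_of_def)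
  obtain \<phi> where \<phi>: "\<phi> \<in> hom C ?D ?B"
    and eq: "pair C f0 g0 \<cdot>\<^bsub>C\<^esub> ?p = pair C \<phi> (Id C ?D) \<cdot>\<^bsub>C\<^esub> (g0 \<cdot>\<^bsub>C\<^esub> ?p)"
    using regular_conditional[OF assms(2) f0 g0'(1) p] by metis
  have indep: "triple C f' d' g' \<cdot>\<^bsub>C\<^esub> ?p = triple C \<phi> (Id C ?D) (Id C ?D) \<cdot>\<^bsub>C\<^esub> state_of Y"
    if f': "f' \<in> reps f" and d': "d' \<in> reps (Comp (sample_cat C) u f)" and g': "g' \<in> reps g"
    for f' d' g'
  proof -
    have f': "f' \<in> hom C ?A ?B" "ae_eq C ?p f' f0"
      using f' f0 by (auto simp: f reps_def ae_class_def ae_eq_def hom_iff)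
    have g': "g' \<in> hom C ?A ?D" "ae_eq C ?p g' g0"
      using g' g0'(1) by (auto simp: g reps_def ae_class_def ae_eq_def hom_iff)
    note d' = reps_Id_Comp[OF assms(2) \<Omega> g0 g d'[unfolded assms(6)]]
    have "triple C f' d' g' \<cdot>\<^bsub>C\<^esub> ?p = triple C f0 g0 g0 \<cdot>\<^bsub>C\<^esub> ?p"
      by (rule triple_cong_state[OF f'(1) f0 d'(1) g0'(1) g'(1) g0'(1) p f'(2) d'(2) g'(2)])
    then show ?thesis
      using triple_deterministic[OF f0 g0'(1) p det \<phi> eq] g0'(2) by simp
  qed
  have "prob_dom f = \<Omega>" "prob_cod f = X" "prob_cod g = Y" "prob_cod u = Y"
    using assms(3-5) by (auto simp: hom_def sample_cat_def prob_cat_def)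
  moreover have "commutative_square (sample_cat C) f g u (Id (sample_cat C) Y)"
    unfolding commutative_square_def using assms(3-6) Id_sample_hom[OF Y] by blast
  ultimately show ?thesis
    unfolding independent_square_def Let_def
    using indep \<phi> Id_hom[OF D] by auto
qed

end
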